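(* For $u\in\mathbb{R}^m$ let $v:=\hat d-\hat F(u)$. Suppose that $r$ is distributed such that the large deviation rate of the RMA error $|J_n(u;r)-J(u)|$ is bounded below by $c\,\dfrac{\delta^2}{2\theta^2}$ for some $c>0$ and $\theta=\|v\|^2/\sqrt2$. Let a cost distortion tolerance $\varepsilon>0$ and a failure rate $\beta>0$ be given, and let $$n\ge\frac{\beta}{c\,\varepsilon^2}.$$ If $u_n^\star$ is a discrepancy principle-satisfying solution for the RMA cost, i.e. $$\frac1n\sum_{j=1}^n\left[r_j^\top\left(\hat d-\hat F(u_n^\star)\right)\right]^2=\tau'N$$ for some $\tau'\approx1$, then with probability at least $1-e^{-\beta}$, $u_n^\star$ is also a solution for the original problem that satisfies Morozov's discrepancy principle with parameter $\tau$, i.e. $$\left\|\hat d-\hat F(u_n^\star)\right\|^2=\tau N\qquad\text{for }\ \tau\in\left[\frac{\tau'}{1+\varepsilon},\ \frac{\tau'}{1-\varepsilon}\right].$$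
   Context: Let $\hat d\in\mathbb{R}^N$ be a (noise-scaled) data vector, $\hat F:\mathbb{R}^m\to\mathbb{R}^N$ a (noise-scaled) parameter-to-observable map, $u_0\in\mathbb{R}^m$ a prior mean, $\|\cdot\|$ the Euclidean norm and $\|\cdot\|_C$ the norm weighted by the inverse square root of the prior covariance. The original problem is to minimize over $u\in\mathbb{R}^m$ $$J(u)=\tfrac12\|\hat d-\hat F(u)\|^2+\tfrac12\|u-u_0\|_C^2 .$$ Let $r$ be a random vector in $\mathbb{R}^N$ with mean zero and identity covariance, and let $r_1,\dots,r_n$ be i.i.d. draws of $r$. The randomized misfit approach (RMA) instead minimizes $$J_n(u;r)=\frac1{2n}\sum_{j=1}^n\left[r_j^\top(\hat d-\hat F(u))\right]^2+\tfrac12\|u-u_0\|_C^2 ,$$ and $u_n^\star$ denotes its minimizer, $u_n^\star:=\arg\min_u J_n(u;r)$. The RMA error has large deviation rate $I(\delta)$ if, for $\delta>0$, $$\mathbb{P}\left[\,|J_n(u;r)-J(u)|>\tfrac{\delta}{2}\right]\le e^{-nI(\delta)}.$$ An inverse solution $u^\star$ satisfies Morozov's discrepancy principle with parameter $\tau$ if $\|\hat d-\hat F(u^\star)\|^2=\tau N$ for some $\tau\approx1$ (where "$\approx1$" is informal).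
   Formalization: Formalized with ε < 1; for a fixed u under the stated rate bound, and for the draw-dependent minimizer u_n* under the extra assumption that the rate bound holds along u_n* (with F̂(u_n* ) measurable), since a bound at each fixed u does not suffice. *)

theory Defs
  imports "HOL-Probability.Probability"
begin

definition sym_pos_def :: "real ^ 'm ^ 'm \<Rightarrow> bool" where
  "sym_pos_def A \<longleftrightarrow> transpose A = A \<and> (\<forall>x. x \<noteq> 0 \<longrightarrow> 0 < x \<bullet> (A *v x))"

text \<open>The inverse square root of a symmetric positive definite matrix is the unique symmetric
  positive definite matrix whose square is the inverse.\<close>

definition inv_sqrt_matrix :: "real ^ 'm ^ 'm \<Rightarrow> real ^ 'm ^ 'm" where
  "inv_sqrt_matrix C = (THE S. sym_pos_def S \<and> S ** S = matrix_inv C)"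

definition weighted_norm :: "real ^ 'm ^ 'm \<Rightarrow> real ^ 'm \<Rightarrow> real" where
  "weighted_norm C u = norm (inv_sqrt_matrix C *v u)"

definition J_cost ::
  "real ^ 'N \<Rightarrow> (real ^ 'm \<Rightarrow> real ^ 'N) \<Rightarrow> real ^ 'm \<Rightarrow> real ^ 'm ^ 'm \<Rightarrow> real ^ 'm \<Rightarrow> real" where
  "J_cost d F u\<^sub>0 C u = 1/2 * (norm (d - F u))\<^sup>2 + 1/2 * (weighted_norm C (u - u\<^sub>0))\<^sup>2"

definition rma_misfit ::
  "real ^ 'N \<Rightarrow> (real ^ 'm \<Rightarrow> real ^ 'N) \<Rightarrow> nat \<Rightarrow> (nat \<Rightarrow> real ^ 'N) \<Rightarrow> real ^ 'm \<Rightarrow> real" where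
  "rma_misfit d F n y u = 1 / real n * (\<Sum>j=1..n. (y j \<bullet> (d - F u))\<^sup>2)"

definition rma_cost ::
  "real ^ 'N \<Rightarrow> (real ^ 'm \<Rightarrow> real ^ 'N) \<Rightarrow> real ^ 'm \<Rightarrow> real ^ 'm ^ 'm
    \<Rightarrow> nat \<Rightarrow> (nat \<Rightarrow> real ^ 'N) \<Rightarrow> real ^ 'm \<Rightarrow> real" where
  "rma_cost d F u\<^sub>0 C n y u =
     1 / (2 * real n) * (\<Sum>j=1..n. (y j \<bullet> (d - F u))\<^sup>2) + 1/2 * (weighted_norm C (u - u\<^sub>0))\<^sup>2"

definition rma_error ::
  "real ^ 'N \<Rightarrow> (real ^ 'm \<Rightarrow> real ^ 'N) \<Rightarrow> real ^ 'm \<Rightarrow> real ^ 'm ^ 'm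
    \<Rightarrow> nat \<Rightarrow> (nat \<Rightarrow> real ^ 'N) \<Rightarrow> real ^ 'm \<Rightarrow> real" where
  "rma_error d F u\<^sub>0 C n y u = \<bar>rma_cost d F u\<^sub>0 C n y u - J_cost d F u\<^sub>0 C u\<bar>"

definition rma_theta :: "real ^ 'N \<Rightarrow> (real ^ 'm \<Rightarrow> real ^ 'N) \<Rightarrow> real ^ 'm \<Rightarrow> real" where
  "rma_theta d F u = (norm (d - F u))\<^sup>2 / sqrt 2"

definition mean_zero :: "'a measure \<Rightarrow> ('a \<Rightarrow> real ^ 'N) \<Rightarrow> bool" where
  "mean_zero M X \<longleftrightarrow> integrable M X \<and> integral\<^sup>L M X = 0"

definition identity_covariance :: "'a measure \<Rightarrow> ('a \<Rightarrow> real ^ 'N) \<Rightarrow> bool" where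
  "identity_covariance M X \<longleftrightarrow>
     (\<forall>i k. let Y = (\<lambda>\<omega>. (X \<omega> $ i - (\<integral>\<xi>. X \<xi> $ i \<partial>M)) * (X \<omega> $ k - (\<integral>\<xi>. X \<xi> $ k \<partial>M)))
            in integrable M Y \<and> integral\<^sup>L M Y = (if i = k then 1 else 0))"

text \<open>The large deviation rate at a fixed parameter \<open>u\<close>; \<open>r j \<omega>\<close> is the \<open>j\<close>-th draw.\<close>

definition rma_ld_rate ::
  "'a measure \<Rightarrow> (nat \<Rightarrow> 'a \<Rightarrow> real ^ 'N) \<Rightarrow> real ^ 'N \<Rightarrow> (real ^ 'm \<Rightarrow> real ^ 'N) \<Rightarrow> real ^ 'm
    \<Rightarrow> real ^ 'm ^ 'm \<Rightarrow> nat \<Rightarrow> real ^ 'm \<Rightarrow> (real \<Rightarrow> real) \<Rightarrow> bool" where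
  "rma_ld_rate M r d F u\<^sub>0 C n u I \<longleftrightarrow>
     (\<forall>\<delta>>0. measure M {\<omega> \<in> space M. rma_error d F u\<^sub>0 C n (\<lambda>j. r j \<omega>) u > \<delta> / 2}
              \<le> exp (- (real n * I \<delta>)))"

text \<open>The same for a parameter \<open>U\<close> that may itself depend on the draws. Then \<open>\<theta>\<close> is random as well,
  and a rate depending on \<open>\<delta> / \<theta>\<close> only is a number exactly when the threshold \<open>\<delta>\<close> is a multiple
  of \<open>\<theta>\<close>; it is therefore given as a function \<open>K\<close> of \<open>s = \<delta> / \<theta>\<close>. If \<open>U\<close> is constant and
  \<open>\<theta> > 0\<close>, this is the previous notion with \<open>I \<delta> = K (\<delta> / \<theta>)\<close>; if \<open>\<theta> = 0\<close>, the error vanishes.\<close>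

definition rma_ld_rate_along ::
  "'a measure \<Rightarrow> (nat \<Rightarrow> 'a \<Rightarrow> real ^ 'N) \<Rightarrow> real ^ 'N \<Rightarrow> (real ^ 'm \<Rightarrow> real ^ 'N) \<Rightarrow> real ^ 'm
    \<Rightarrow> real ^ 'm ^ 'm \<Rightarrow> nat \<Rightarrow> ('a \<Rightarrow> real ^ 'm) \<Rightarrow> (real \<Rightarrow> real) \<Rightarrow> bool" where
  "rma_ld_rate_along M r d F u\<^sub>0 C n U K \<longleftrightarrow>
     (\<forall>s>0. measure M {\<omega> \<in> space M. rma_error d F u\<^sub>0 C n (\<lambda>j. r j \<omega>) (U \<omega>)
                                     > s * rma_theta d F (U \<omega>) / 2}
              \<le> exp (- (real n * K s)))"

definition rma_discrepancy ::
  "real ^ 'N \<Rightarrow> (real ^ 'm \<Rightarrow> real ^ 'N) \<Rightarrow> nat \<Rightarrow> (nat \<Rightarrow> real ^ 'N) \<Rightarrow> real \<Rightarrow> real ^ 'm \<Rightarrow> bool" where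
  "rma_discrepancy d F n y \<tau>' u \<longleftrightarrow> rma_misfit d F n y u = \<tau>' * real CARD('N)"

definition morozov_discrepancy ::
  "real ^ 'N \<Rightarrow> (real ^ 'm \<Rightarrow> real ^ 'N) \<Rightarrow> real \<Rightarrow> real ^ 'm \<Rightarrow> bool" where
  "morozov_discrepancy d F \<tau> u \<longleftrightarrow> (norm (d - F u))\<^sup>2 = \<tau> * real CARD('N)"

text \<open>Stated through an event inside the set where \<open>P\<close> holds, because that set need not be
  measurable and \<^const>\<open>measure\<close> is \<open>0\<close> on non-measurable sets.\<close>

definition with_prob_at_least :: "'a measure \<Rightarrow> real \<Rightarrow> ('a \<Rightarrow> bool) \<Rightarrow> bool" where
  "with_prob_at_least M p P \<longleftrightarrow> (\<exists>A\<in>sets M. p \<le> measure M A \<and> (\<forall>\<omega>\<in>A. P \<omega>))"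

end

theory Submission
  imports Defs
begin

text \<open>In the RMA error the two prior terms cancel, so that it is half the distance between the
  randomized and the exact misfit (\<open>rma_error_eq_half_misfit_difference\<close>). Writing \<open>v\<close> for the
  residual, the relative bound
  \<open>\<bar>misfit - \<parallel>v\<parallel>\<^sup>2\<bar> \<le> \<epsilon> \<parallel>v\<parallel>\<^sup>2\<close> is therefore the complement of the
  large deviation event at threshold \<open>\<delta> = \<epsilon> \<parallel>v\<parallel>\<^sup>2\<close>. In units of
  \<open>\<theta> = \<parallel>v\<parallel>\<^sup>2 / sqrt 2\<close> this threshold is \<open>s = \<epsilon> sqrt 2\<close>, independently of
  \<open>v\<close>; a rate of at least \<open>c s\<^sup>2 / 2\<close> is then at least \<open>c \<epsilon>\<^sup>2\<close>, and the
  lower bound on the number of draws makes the failure probability at most \<open>exp (- \<beta>)\<close>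
  (\<open>rma_relative_misfit_bound_whp\<close>). On the good event a randomized misfit \<open>\<tau>' N\<close> lies
  between \<open>(1 - \<epsilon>) \<parallel>v\<parallel>\<^sup>2\<close> and \<open>(1 + \<epsilon>) \<parallel>v\<parallel>\<^sup>2\<close>, which is the
  claimed range for \<open>\<tau> = \<parallel>v\<parallel>\<^sup>2 / N\<close> (\<open>morozov_of_relative_misfit_bound\<close>).

  A fixed parameter is the special case of a constant random one, since a rate in \<open>\<delta>\<close> turns
  into a rate in \<open>\<delta> / \<theta>\<close> (\<open>rma_ld_rate_imp_along_const\<close>). For a parameter that
  depends on the draws the concentration has to be assumed along that parameter: a bound at
  each fixed parameter does not control one that is selected by looking at the draws.\<close>

lemma rma_error_eq_half_misfit_difference:
  "rma_error d F u\<^sub>0 C n y u = \<bar>rma_misfit d F n y u - (norm (d - F u))\<^sup>2\<bar> / 2"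
  unfolding rma_error_def rma_cost_def J_cost_def rma_misfit_def
  by (simp add: field_simps abs_if)

lemma borel_measurable_rma_misfit:
  fixes F :: "real ^ 'm \<Rightarrow> real ^ 'N"
  assumes "\<And>j. j \<in> {1..n} \<Longrightarrow> r j \<in> borel_measurable M"
    and "(\<lambda>\<omega>. F (U \<omega>)) \<in> borel_measurable M"
  shows "(\<lambda>\<omega>. rma_misfit d F n (\<lambda>j. r j \<omega>) (U \<omega>)) \<in> borel_measurable M"
  unfolding rma_misfit_def
  by (intro borel_measurable_times borel_measurable_const borel_measurable_sum
      borel_measurable_power borel_measurable_inner borel_measurable_diff assms)

lemma morozov_of_relative_misfit_bound:
  fixes d :: "real ^ 'N"
  assumes "0 < \<epsilon>" "\<epsilon> < 1"
    and disc: "rma_discrepancy d F n y \<tau>' u"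
    and close: "\<bar>rma_misfit d F n y u - (norm (d - F u))\<^sup>2\<bar> \<le> \<epsilon> * (norm (d - F u))\<^sup>2"
  shows "\<exists>\<tau>\<in>{\<tau>' / (1 + \<epsilon>)..\<tau>' / (1 - \<epsilon>)}. morozov_discrepancy d F \<tau> u"
proof
  define N where "N = real CARD('N)"
  define q where "q = (norm (d - F u))\<^sup>2"
  have N: "N > 0" by (simp add: N_def)
  have "\<bar>\<tau>' * N - q\<bar> \<le> \<epsilon> * q"
    using close disc by (simp add: rma_discrepancy_def N_def q_def)
  then have "\<tau>' * N \<le> q * (1 + \<epsilon>)" "q * (1 - \<epsilon>) \<le> \<tau>' * N"
    by (auto simp: algebra_simps)
  then show "q / N \<in> {\<tau>' / (1 + \<epsilon>)..\<tau>' / (1 - \<epsilon>)}"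
    using N assms(1,2) by (simp add: field_simps)
  show "morozov_discrepancy d F (q / N) u"
    using N by (simp add: morozov_discrepancy_def q_def N_def)
qed

text \<open>Where \<open>\<theta> > 0\<close>, the substitution \<open>\<delta> = s \<theta>\<close> turns the quadratic lower
  bound on the rate into \<open>c s\<^sup>2 / 2\<close>. Where \<open>\<theta> = 0\<close>, that lower bound degenerates to
  \<open>0\<close>, but then the residual vanishes and with it the error, so that the deviation event is
  empty.\<close>

lemma rma_ld_rate_imp_along_const:
  assumes rate: "rma_ld_rate M r d F u\<^sub>0 C n u I"
    and I_ge: "\<forall>\<delta>>0. I \<delta> \<ge> c * (\<delta>\<^sup>2 / (2 * (rma_theta d F u)\<^sup>2))"
  shows "rma_ld_rate_along M r d F u\<^sub>0 C n (\<lambda>_. u) (\<lambda>s. c * (s\<^sup>2 / 2))"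
  unfolding rma_ld_rate_along_def
proof (intro allI impI)
  fix s :: real
  assume s: "s > 0"
  let ?E = "{\<omega> \<in> space M. rma_error d F u\<^sub>0 C n (\<lambda>j. r j \<omega>) u > s * rma_theta d F u / 2}"
  show "measure M ?E \<le> exp (- (real n * (c * (s\<^sup>2 / 2))))"
  proof (cases "d - F u = 0")
    case True
    then have "?E = {}"
      by (simp add: rma_error_eq_half_misfit_difference rma_misfit_def rma_theta_def)
    then show ?thesis by (simp only: measure_empty exp_ge_zero)
  next
    case False
    then have \<theta>: "rma_theta d F u > 0" by (simp add: rma_theta_def)
    then have pos: "s * rma_theta d F u > 0" using s by simp
    have "c * (s\<^sup>2 / 2) = c * ((s * rma_theta d F u)\<^sup>2 / (2 * (rma_theta d F u)\<^sup>2))"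
      using \<theta> by (simp add: power_mult_distrib)
    also have "\<dots> \<le> I (s * rma_theta d F u)"
      using I_ge pos by blast
    finally have "real n * (c * (s\<^sup>2 / 2)) \<le> real n * I (s * rma_theta d F u)"
      by (rule mult_left_mono) simp
    moreover have "measure M ?E \<le> exp (- (real n * I (s * rma_theta d F u)))"
      using rate pos unfolding rma_ld_rate_def by blast
    ultimately show ?thesis
      by (meson exp_le_cancel_iff neg_le_iff_le order_trans)
  qed
qed

text \<open>The threshold \<open>\<epsilon> \<parallel>v\<parallel>\<^sup>2\<close> is \<open>\<theta>\<close> times the number
  \<open>\<epsilon> sqrt 2\<close>, so the rate along \<open>U\<close> applies to it although the residual \<open>v\<close> is
  random.\<close>

lemma rma_relative_misfit_bound_whp:
  fixes F :: "real ^ 'm \<Rightarrow> real ^ 'N"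
  assumes "prob_space M"
    and draws: "\<And>j. j \<in> {1..n} \<Longrightarrow> r j \<in> borel_measurable M"
    and FU: "(\<lambda>\<omega>. F (U \<omega>)) \<in> borel_measurable M"
    and rate: "rma_ld_rate_along M r d F u\<^sub>0 C n U K"
    and K_ge: "\<forall>s>0. K s \<ge> c * (s\<^sup>2 / 2)"
    and "c > 0" "\<epsilon> > 0"
    and n_ge: "real n \<ge> \<beta> / (c * \<epsilon>\<^sup>2)"
  shows "with_prob_at_least M (1 - exp (- \<beta>))
           (\<lambda>\<omega>. \<bar>rma_misfit d F n (\<lambda>j. r j \<omega>) (U \<omega>) - (norm (d - F (U \<omega>)))\<^sup>2\<bar>
                \<le> \<epsilon> * (norm (d - F (U \<omega>)))\<^sup>2)"
proof -
  interpret prob_space M by fact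
  let ?m = "\<lambda>\<omega>. rma_misfit d F n (\<lambda>j. r j \<omega>) (U \<omega>)"
  let ?q = "\<lambda>\<omega>. (norm (d - F (U \<omega>)))\<^sup>2"
  let ?B = "{\<omega> \<in> space M. \<bar>?m \<omega> - ?q \<omega>\<bar> > \<epsilon> * ?q \<omega>}"
  have [measurable]: "?m \<in> borel_measurable M"
    using draws FU by (rule borel_measurable_rma_misfit)
  note FU [measurable]
  have B: "?B \<in> events" by measurable
  have "?B = {\<omega> \<in> space M. rma_error d F u\<^sub>0 C n (\<lambda>j. r j \<omega>) (U \<omega>)
                              > \<epsilon> * sqrt 2 * rma_theta d F (U \<omega>) / 2}"
    by (simp add: rma_error_eq_half_misfit_difference rma_theta_def)
  moreover have "\<epsilon> * sqrt 2 > 0" using \<open>\<epsilon> > 0\<close> by simp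
  ultimately have "prob ?B \<le> exp (- (real n * K (\<epsilon> * sqrt 2)))"
    and "c * ((\<epsilon> * sqrt 2)\<^sup>2 / 2) \<le> K (\<epsilon> * sqrt 2)"
    using rate K_ge unfolding rma_ld_rate_along_def by auto
  moreover from this have "real n * (c * \<epsilon>\<^sup>2) \<le> real n * K (\<epsilon> * sqrt 2)"
    by (intro mult_left_mono) (simp_all add: power_mult_distrib)
  moreover have "\<beta> \<le> real n * (c * \<epsilon>\<^sup>2)"
    using n_ge \<open>c > 0\<close> \<open>\<epsilon> > 0\<close> by (simp add: pos_divide_le_eq)
  ultimately have "prob ?B \<le> exp (- \<beta>)"
    by (meson exp_le_cancel_iff neg_le_iff_le order_trans)
  then have "1 - exp (- \<beta>) \<le> prob (space M - ?B)"
    using B by (simp add: prob_compl)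
  then show ?thesis
    unfolding with_prob_at_least_def using B
    by (intro bexI[of _ "space M - ?B"]) (auto simp: not_less)
qed

lemma with_prob_at_least_mono:
  assumes "with_prob_at_least M p P" "\<And>\<omega>. P \<omega> \<Longrightarrow> Q \<omega>"
  shows "with_prob_at_least M p Q"
  using assms unfolding with_prob_at_least_def by blast

theorem theorem2:
  fixes M :: "'a measure"
    and r :: "nat \<Rightarrow> 'a \<Rightarrow> real ^ 'N"
    and d :: "real ^ 'N"
    and F :: "real ^ 'm \<Rightarrow> real ^ 'N"
    and u\<^sub>0 :: "real ^ 'm"
    and C :: "real ^ 'm ^ 'm"
    and n :: nat
    and c \<epsilon> \<beta> :: real
  assumes "prob_space M"
    and "sym_pos_def C"
    and draws_rv: "\<And>j. j \<in> {1..n} \<Longrightarrow> r j \<in> borel_measurable M"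
    and draws_indep: "prob_space.indep_vars M (\<lambda>_. borel) r {1..n}"
    and draws_ident: "\<And>i j. i \<in> {1..n} \<Longrightarrow> j \<in> {1..n} \<Longrightarrow> distr M borel (r i) = distr M borel (r j)"
    and draws_mean: "\<And>j. j \<in> {1..n} \<Longrightarrow> mean_zero M (r j)"
    and draws_cov: "\<And>j. j \<in> {1..n} \<Longrightarrow> identity_covariance M (r j)"
    and "c > 0"
    and ld: "\<And>u. \<exists>I. rma_ld_rate M r d F u\<^sub>0 C n u I \<and>
                     (\<forall>\<delta>>0. I \<delta> \<ge> c * (\<delta>\<^sup>2 / (2 * (rma_theta d F u)\<^sup>2)))"
    and "0 < \<epsilon>" and "\<epsilon> < 1" and "0 < \<beta>"
    and n_ge: "real n \<ge> \<beta> / (c * \<epsilon>\<^sup>2)"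
  shows "(\<forall>u. with_prob_at_least M (1 - exp (- \<beta>))
            (\<lambda>\<omega>. \<forall>\<tau>'. rma_discrepancy d F n (\<lambda>j. r j \<omega>) \<tau>' u \<longrightarrow>
                   (\<exists>\<tau>\<in>{\<tau>' / (1 + \<epsilon>)..\<tau>' / (1 - \<epsilon>)}. morozov_discrepancy d F \<tau> u)))
       \<and> (\<forall>u\<^sub>n K.
            u\<^sub>n \<in> borel_measurable M \<longrightarrow>
            (\<lambda>\<omega>. F (u\<^sub>n \<omega>)) \<in> borel_measurable M \<longrightarrow>
            rma_ld_rate_along M r d F u\<^sub>0 C n u\<^sub>n K \<longrightarrow>
            (\<forall>s>0. K s \<ge> c * (s\<^sup>2 / 2)) \<longrightarrow>
            with_prob_at_least M (1 - exp (- \<beta>))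
              (\<lambda>\<omega>. \<forall>\<tau>'. is_arg_min (rma_cost d F u\<^sub>0 C n (\<lambda>j. r j \<omega>)) (\<lambda>_. True) (u\<^sub>n \<omega>) \<longrightarrow>
                     rma_discrepancy d F n (\<lambda>j. r j \<omega>) \<tau>' (u\<^sub>n \<omega>) \<longrightarrow>
                     (\<exists>\<tau>\<in>{\<tau>' / (1 + \<epsilon>)..\<tau>' / (1 - \<epsilon>)}. morozov_discrepancy d F \<tau> (u\<^sub>n \<omega>))))"
proof (intro conjI allI impI)
  fix u
  obtain I where "rma_ld_rate M r d F u\<^sub>0 C n u I"
    "\<forall>\<delta>>0. I \<delta> \<ge> c * (\<delta>\<^sup>2 / (2 * (rma_theta d F u)\<^sup>2))"
    using ld by blast
  then have "rma_ld_rate_along M r d F u\<^sub>0 C n (\<lambda>_. u) (\<lambda>s. c * (s\<^sup>2 / 2))"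
    by (rule rma_ld_rate_imp_along_const)
  from rma_relative_misfit_bound_whp[OF \<open>prob_space M\<close> draws_rv
      borel_measurable_const this _ \<open>c > 0\<close> \<open>0 < \<epsilon>\<close> n_ge]
  have "with_prob_at_least M (1 - exp (- \<beta>))
          (\<lambda>\<omega>. \<bar>rma_misfit d F n (\<lambda>j. r j \<omega>) u - (norm (d - F u))\<^sup>2\<bar>
               \<le> \<epsilon> * (norm (d - F u))\<^sup>2)"
    by simp
  then show "with_prob_at_least M (1 - exp (- \<beta>))
            (\<lambda>\<omega>. \<forall>\<tau>'. rma_discrepancy d F n (\<lambda>j. r j \<omega>) \<tau>' u \<longrightarrow>
                   (\<exists>\<tau>\<in>{\<tau>' / (1 + \<epsilon>)..\<tau>' / (1 - \<epsilon>)}. morozov_discrepancy d F \<tau> u))"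
    by (rule with_prob_at_least_mono)
      (intro allI impI morozov_of_relative_misfit_bound \<open>0 < \<epsilon>\<close> \<open>\<epsilon> < 1\<close>)
next
  fix u\<^sub>n K
  assume FU: "(\<lambda>\<omega>. F (u\<^sub>n \<omega>)) \<in> borel_measurable M"
    and rate: "rma_ld_rate_along M r d F u\<^sub>0 C n u\<^sub>n K"
    and K: "\<forall>s>0. K s \<ge> c * (s\<^sup>2 / 2)"
  have "with_prob_at_least M (1 - exp (- \<beta>))
          (\<lambda>\<omega>. \<bar>rma_misfit d F n (\<lambda>j. r j \<omega>) (u\<^sub>n \<omega>) - (norm (d - F (u\<^sub>n \<omega>)))\<^sup>2\<bar>
               \<le> \<epsilon> * (norm (d - F (u\<^sub>n \<omega>)))\<^sup>2)"
    using \<open>prob_space M\<close> draws_rv FU rate K \<open>c > 0\<close> \<open>0 < \<epsilon>\<close> n_ge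
    by (rule rma_relative_misfit_bound_whp)
  then show "with_prob_at_least M (1 - exp (- \<beta>))
              (\<lambda>\<omega>. \<forall>\<tau>'. is_arg_min (rma_cost d F u\<^sub>0 C n (\<lambda>j. r j \<omega>)) (\<lambda>_. True) (u\<^sub>n \<omega>) \<longrightarrow>
                     rma_discrepancy d F n (\<lambda>j. r j \<omega>) \<tau>' (u\<^sub>n \<omega>) \<longrightarrow>
                     (\<exists>\<tau>\<in>{\<tau>' / (1 + \<epsilon>)..\<tau>' / (1 - \<epsilon>)}. morozov_discrepancy d F \<tau> (u\<^sub>n \<omega>)))"
    by (rule with_prob_at_least_mono)
      (intro allI impI morozov_of_relative_misfit_bound \<open>0 < \<epsilon>\<close> \<open>\<epsilon> < 1\<close>)
qed

end
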